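(* Let $m,n,p\ge 0$ be integers. There is a sign reversing involution $\tau$ on the set of non-degenerate rooted synchronized partitions of $p$ in $\mathcal{R}_{m,n}$; that is, there is a map $\tau$ from this set to itself such that $\tau(\tau(S))=S$ and the sign of $\tau(S)$ is the negative of the sign of $S$ for every $S$ in the set.
   Context: Let $\alpha=(\alpha_1>\alpha_2>\cdots>\alpha_r)$ be a (possibly empty) partition with distinct positive parts, and let $\beta=(\beta_1>\beta_2>\cdots>\beta_s)$ be a (possibly empty) partition with distinct nonnegative parts, i.e. the last part $\beta_s$ is allowed to be $0$ (a zero part counts towards the length). Write $l(\alpha)=r$, $l(\beta)=s$, and $|\alpha|,|\beta|$ for the sums of parts. The synchronized partition $S(\alpha,\beta)$ is the two-row array with top row $\alpha$ and bottom row $\beta$, in which $|r-s|$ symbols $*$ are appended at the end of the shorter row so that both rows have the same length (no stars if $r=s$). It is a synchronized partition of $p=|\alpha|+|\beta|$. The discrepancy is $r-s$. Stars are in the bottom row if $r>s$ and in the top row if $r<s$. A rooted synchronized partition is a synchronized partition (necessarily of nonzero discrepancy) together with one distinguished star among its $|r-s|$ stars, denoted $\bar{*}$ (the barred star). The set $\mathcal{R}_{m,n}$ consists of all rooted synchronized partitions $S(\alpha,\beta)$ with $\alpha_1\le m$ and $\beta_1\le n$ (each condition being vacuous if the corresponding partition is empty). A rooted synchronized partition is called degenerate if it has one of the following two forms: (i) $l(\alpha)>l(\beta)$, $\beta$ has no zero part, and the barred star is the first (leftmost) star of the bottom row; (ii) $l(\alpha)<l(\beta)$, $\beta$ has a zero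 part, and the barred star is the last (rightmost) star of the top row, i.e. the one in the same column as the zero part. Otherwise it is called non-degenerate. The sign of a rooted synchronized partition $S$ is $(-1)^{\delta(S)}$, where $\delta(S)$ is the number of stars in $S$, except that a barred star in the top row is not counted (a barred star in the bottom row is counted). So $\delta(S)=l(\alpha)-l(\beta)$ if $l(\alpha)>l(\beta)$, and $\delta(S)=l(\beta)-l(\alpha)-1$ if $l(\alpha)<l(\beta)$. *)

theory Defs
  imports Main
begin

text \<open>Partitions with distinct parts are represented as strictly decreasing lists.\<close>

definition pos_distinct_partition :: "nat list \<Rightarrow> bool" where
  "pos_distinct_partition \<alpha> \<longleftrightarrow> sorted_wrt (>) \<alpha> \<and> (\<forall>a\<in>set \<alpha>. 0 < a)"

definition nonneg_distinct_partition :: "nat list \<Rightarrow> bool" where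
  "nonneg_distinct_partition \<beta> \<longleftrightarrow> sorted_wrt (>) \<beta>"

datatype entry = Part nat | Star | BarStar

text \<open>A two-row array is the pair (top row, bottom row).\<close>

type_synonym array = "entry list \<times> entry list"

text \<open>Natural number subtraction truncates, so at most one row receives stars.\<close>

definition sync :: "nat list \<Rightarrow> nat list \<Rightarrow> array" where
  "sync \<alpha> \<beta> =
     (map Part \<alpha> @ replicate (length \<beta> - length \<alpha>) Star,
      map Part \<beta> @ replicate (length \<alpha> - length \<beta>) Star)"

text \<open>\<open>rooting S T\<close>: the array \<open>T\<close> is \<open>S\<close> with exactly one of its stars barred.\<close>

definition rooting :: "array \<Rightarrow> array \<Rightarrow> bool" where
  "rooting S T \<longleftrightarrow>
     (\<exists>c < length (fst S). fst S ! c = Star \<and> T = ((fst S)[c := BarStar], snd S)) \<or>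
     (\<exists>c < length (snd S). snd S ! c = Star \<and> T = (fst S, (snd S)[c := BarStar]))"

definition rooted_sync_partitions :: "nat \<Rightarrow> nat \<Rightarrow> array set" where
  "rooted_sync_partitions m n =
     {T. \<exists>\<alpha> \<beta>. pos_distinct_partition \<alpha> \<and> nonneg_distinct_partition \<beta> \<and>
           (\<alpha> \<noteq> [] \<longrightarrow> hd \<alpha> \<le> m) \<and> (\<beta> \<noteq> [] \<longrightarrow> hd \<beta> \<le> n) \<and>
           rooting (sync \<alpha> \<beta>) T}"

text \<open>Reading \<open>\<alpha>\<close> and \<open>\<beta>\<close> back off the two rows.\<close>

fun parts :: "entry list \<Rightarrow> nat list" where
  "parts [] = []"
| "parts (Part k # es) = k # parts es"
| "parts (Star # es) = parts es"
| "parts (BarStar # es) = parts es"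

definition top_parts :: "array \<Rightarrow> nat list" where
  "top_parts S = parts (fst S)"

definition bottom_parts :: "array \<Rightarrow> nat list" where
  "bottom_parts S = parts (snd S)"

definition weight :: "array \<Rightarrow> nat" where
  "weight S = sum_list (top_parts S) + sum_list (bottom_parts S)"

text \<open>The stars of a row follow its parts, so the first star of the bottom row sits
  at (0-based) position \<open>length (bottom_parts S)\<close>, and the last star of the top row is the
  last entry of that row.\<close>

definition degenerate :: "array \<Rightarrow> bool" where
  "degenerate S \<longleftrightarrow>
     (length (top_parts S) > length (bottom_parts S) \<and> 0 \<notin> set (bottom_parts S) \<and>
        snd S ! length (bottom_parts S) = BarStar) \<or>
     (length (top_parts S) < length (bottom_parts S) \<and> 0 \<in> set (bottom_parts S) \<and>
        last (fst S) = BarStar)"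

text \<open>All stars count, except a barred star in the top row.\<close>

definition star_count :: "array \<Rightarrow> nat" where
  "star_count S = count_list (fst S) Star + count_list (snd S) Star + count_list (snd S) BarStar"

definition sync_sign :: "array \<Rightarrow> int" where
  "sync_sign S = (- 1) ^ star_count S"

definition nondegenerate_rooted :: "nat \<Rightarrow> nat \<Rightarrow> nat \<Rightarrow> array set" where
  "nondegenerate_rooted m n p =
     {S \<in> rooted_sync_partitions m n. weight S = p \<and> \<not> degenerate S}"

end

theory Submission
  imports Defs
begin

text \<open>
  The involution inserts a part \<open>0\<close> into \<open>\<beta>\<close>, or deletes it if it is there, and leaves
  \<open>\<alpha>\<close> and the column of the barred star alone. This changes neither the weight nor the bounds
  on the parts, and it moves \<open>l(\<beta>)\<close> by one, which changes the number of stars by one and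
  hence the sign.

  The only obstruction is that the barred column must hold a star both before and after the move.
  The starred columns form the interval between \<open>l(\<alpha>)\<close> and \<open>l(\<beta>)\<close>. If \<open>l(\<alpha>) > l(\<beta>)\<close>,
  inserting a zero destroys exactly the first bottom star; if \<open>l(\<alpha>) < l(\<beta>)\<close>, deleting the
  zero destroys exactly the last top star; in the other two cases no star is lost. So the rooted
  arrays on which the move is impossible are precisely the degenerate ones
  (\<open>degenerate_iff_toggle_unstars\<close>). Non-degeneracy thus says that the barred column is starred
  for both \<open>\<beta>\<close> and the toggled \<open>\<beta>\<close>, a condition symmetric under the move.

  To argue this way, rooted arrays are coordinatized by triples \<open>(\<alpha>, \<beta>, c)\<close>, where \<open>c\<close> is a
  starred column; all three components can be read off from the array.
\<close>

section \<open>Rooted arrays as triples\<close>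

text \<open>Allowing \<open>N \<le> length xs\<close>, where no star is appended, gives both rows of an array the same
  description, whichever of them is the shorter one.\<close>

definition starred_row :: "nat list \<Rightarrow> nat \<Rightarrow> nat \<Rightarrow> entry list" where
  "starred_row xs N c =
     map Part xs @ map (\<lambda>i. if i = c then BarStar else Star) [length xs..<N]"

definition rooted_array :: "nat list \<Rightarrow> nat list \<Rightarrow> nat \<Rightarrow> array" where
  "rooted_array \<alpha> \<beta> c = (starred_row \<alpha> (length \<beta>) c, starred_row \<beta> (length \<alpha>) c)"

definition star_columns :: "nat list \<Rightarrow> nat list \<Rightarrow> nat set" where
  "star_columns \<alpha> \<beta> = {min (length \<alpha>) (length \<beta>)..<max (length \<alpha>) (length \<beta>)}"

definition root_column :: "array \<Rightarrow> nat" where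
  "root_column S =
     (THE c. c < length (fst S) \<and> (fst S ! c = BarStar \<or> snd S ! c = BarStar))"

lemma length_starred_row [simp]: "length (starred_row xs N c) = max (length xs) N"
  by (simp add: starred_row_def)

lemma nth_starred_row:
  assumes "i < max (length xs) N"
  shows "starred_row xs N c ! i =
    (if i < length xs then Part (xs ! i) else if i = c then BarStar else Star)"
  using assms by (auto simp: starred_row_def nth_append)

lemma parts_append: "parts (xs @ ys) = parts xs @ parts ys"
  by (induction xs rule: parts.induct) auto

lemma parts_map_Part: "parts (map Part xs) = xs"
  by (induction xs) auto

lemma parts_eq_Nil: "\<forall>e\<in>set es. e = Star \<or> e = BarStar \<Longrightarrow> parts es = []"
  by (induction es rule: parts.induct) auto

lemma parts_starred_row [simp]: "parts (starred_row xs N c) = xs"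
proof -
  have "parts (map (\<lambda>i. if i = c then BarStar else Star) [length xs..<N]) = []"
    by (rule parts_eq_Nil) auto
  then show ?thesis
    by (simp add: starred_row_def parts_append parts_map_Part)
qed

lemma top_parts_rooted_array [simp]: "top_parts (rooted_array \<alpha> \<beta> c) = \<alpha>"
  by (simp add: top_parts_def rooted_array_def)

lemma bottom_parts_rooted_array [simp]: "bottom_parts (rooted_array \<alpha> \<beta> c) = \<beta>"
  by (simp add: bottom_parts_def rooted_array_def)

lemma weight_rooted_array: "weight (rooted_array \<alpha> \<beta> c) = sum_list \<alpha> + sum_list \<beta>"
  by (simp add: weight_def)

lemma root_column_rooted_array:
  assumes "c \<in> star_columns \<alpha> \<beta>"
  shows "root_column (rooted_array \<alpha> \<beta> c) = c"
  unfolding root_column_def rooted_array_def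
  using assms
  by (intro the_equality)
     (auto simp: nth_starred_row star_columns_def max.commute split: if_splits)

lemma starred_row_eq_update:
  assumes "length xs \<le> c" "c < N"
  shows "(map Part xs @ replicate (N - length xs) Star)[c := BarStar] = starred_row xs N c"
  using assms by (intro nth_equalityI) (auto simp: nth_starred_row nth_append nth_list_update)

lemma starred_row_eq_map_Part: "N \<le> length xs \<Longrightarrow> starred_row xs N c = map Part xs"
  by (simp add: starred_row_def)

lemma rooting_sync_iff:
  "rooting (sync \<alpha> \<beta>) T \<longleftrightarrow> (\<exists>c \<in> star_columns \<alpha> \<beta>. T = rooted_array \<alpha> \<beta> c)"
proof -
  have star: "c < length (map Part xs @ replicate (N - length xs) Star) \<and>
      (map Part xs @ replicate (N - length xs) Star) ! c = Star \<longleftrightarrow> length xs \<le> c \<and> c < N"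
    for xs N c
    by (auto simp: nth_append)
  have "rooting (sync \<alpha> \<beta>) T \<longleftrightarrow>
      (\<exists>c. length \<alpha> \<le> c \<and> c < length \<beta> \<and> T = rooted_array \<alpha> \<beta> c) \<or>
      (\<exists>c. length \<beta> \<le> c \<and> c < length \<alpha> \<and> T = rooted_array \<alpha> \<beta> c)"
    unfolding rooting_def sync_def fst_conv snd_conv conj_assoc [symmetric] star
    by (intro arg_cong2 [where f = "(\<or>)"] ex_cong1)
       (auto simp: rooted_array_def starred_row_eq_update starred_row_eq_map_Part)
  also have "\<dots> \<longleftrightarrow> (\<exists>c \<in> star_columns \<alpha> \<beta>. T = rooted_array \<alpha> \<beta> c)"
    by (auto simp: star_columns_def min_def max_def)
  finally show ?thesis .
qed

section \<open>The sign\<close>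

lemma count_list_star_block:
  "count_list (map (\<lambda>i. if i = c then BarStar else Star) [k..<N]) Star =
     (N - k) - of_bool (k \<le> c \<and> c < N)"
  "count_list (map (\<lambda>i. if i = c then BarStar else Star) [k..<N]) BarStar =
     of_bool (k \<le> c \<and> c < N)"
  by (induction N) (auto simp: of_bool_def)

lemma count_list_map_Part:
  "count_list (map Part xs) Star = 0" "count_list (map Part xs) BarStar = 0"
  by (induction xs) auto

text \<open>Since a barred top star does not count, the sign is the parity of the discrepancy, negated
  when the stars are in the top row. A change of \<open>l(\<beta>)\<close> by one therefore flips the sign as long
  as the stars stay in the same row.\<close>

lemma sync_sign_rooted_array:
  assumes "c \<in> star_columns \<alpha> \<beta>"
  shows "sync_sign (rooted_array \<alpha> \<beta> c) =
    (if length \<beta> < length \<alpha> then 1 else - 1) * (- 1) ^ (length \<alpha> + length \<beta>)"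
proof (cases "length \<beta> < length \<alpha>")
  case True
  then have "star_count (rooted_array \<alpha> \<beta> c) = length \<alpha> - length \<beta>"
    using assms
    by (auto simp: star_count_def rooted_array_def starred_row_def star_columns_def
        count_list_star_block count_list_map_Part)
  moreover obtain d where "length \<alpha> = length \<beta> + d"
    using True by (metis less_imp_add_positive)
  ultimately show ?thesis
    using True by (simp add: sync_sign_def power_add flip: power_mult_distrib)
next
  case False
  then have "star_count (rooted_array \<alpha> \<beta> c) = length \<beta> - length \<alpha> - 1"
    using assms
    by (auto simp: star_count_def rooted_array_def starred_row_def star_columns_def
        count_list_star_block count_list_map_Part)
  moreover obtain d where "length \<beta> = length \<alpha> + Suc d"
    using False assms less_imp_Suc_add [of "length \<alpha>" "length \<beta>"]
    by (auto simp: star_columns_def)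
  ultimately show ?thesis
    using False by (simp add: sync_sign_def power_add flip: power_mult_distrib)
qed

section \<open>Toggling the zero part\<close>

definition toggle_zero :: "nat list \<Rightarrow> nat list" where
  "toggle_zero \<beta> = (if 0 \<in> set \<beta> then butlast \<beta> else \<beta> @ [0])"

text \<open>In a strictly decreasing list a zero can only be the last entry, so toggling is one move
  and its inverse.\<close>

lemma toggle_zero_cases:
  assumes "nonneg_distinct_partition \<beta>"
  obtains (insert) "0 \<notin> set \<beta>" "toggle_zero \<beta> = \<beta> @ [0]"
  | (delete) \<gamma> where "0 \<notin> set \<gamma>" "\<beta> = \<gamma> @ [0]" "toggle_zero \<beta> = \<gamma>"
proof (cases "0 \<in> set \<beta>")
  case True
  then obtain \<gamma> \<delta> where \<beta>: "\<beta> = \<gamma> @ 0 # \<delta>"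
    by (meson split_list)
  with assms have "\<delta> = []"
    by (cases \<delta>) (auto simp: nonneg_distinct_partition_def sorted_wrt_append)
  moreover from this \<beta> assms have "0 \<notin> set \<gamma>"
    by (auto simp: nonneg_distinct_partition_def sorted_wrt_append)
  ultimately show thesis
    using \<beta> by (intro delete) (auto simp: toggle_zero_def)
qed (simp add: insert toggle_zero_def)

lemma
  assumes "nonneg_distinct_partition \<beta>"
  shows nonneg_distinct_partition_toggle_zero: "nonneg_distinct_partition (toggle_zero \<beta>)"
    and toggle_zero_toggle_zero: "toggle_zero (toggle_zero \<beta>) = \<beta>"
    and sum_list_toggle_zero: "sum_list (toggle_zero \<beta>) = sum_list \<beta>"
    and hd_toggle_zero_le:
      "\<beta> \<noteq> [] \<longrightarrow> hd \<beta> \<le> n \<Longrightarrow> toggle_zero \<beta> \<noteq> [] \<longrightarrow> hd (toggle_zero \<beta>) \<le> n"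
  using assms
  by (cases rule: toggle_zero_cases;
      auto simp: nonneg_distinct_partition_def sorted_wrt_append toggle_zero_def hd_append
        intro: gr0I)+

text \<open>Inserting a zero turns the first bottom star into a part; deleting one removes the column of
  the last top star. Degeneracy says that this star is the barred one.\<close>

lemma degenerate_iff_toggle_unstars:
  assumes "nonneg_distinct_partition \<beta>" "c \<in> star_columns \<alpha> \<beta>"
  shows "degenerate (rooted_array \<alpha> \<beta> c) \<longleftrightarrow> c \<notin> star_columns \<alpha> (toggle_zero \<beta>)"
proof -
  have first_bottom: "snd (rooted_array \<alpha> \<beta> c) ! length \<beta> = BarStar \<longleftrightarrow> c = length \<beta>"
    if "length \<beta> < length \<alpha>"
    using that by (auto simp: rooted_array_def nth_starred_row)
  have last_top: "last (fst (rooted_array \<alpha> \<beta> c)) = BarStar \<longleftrightarrow> c = length \<beta> - 1"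
    if "length \<alpha> < length \<beta>"
  proof -
    have "length (fst (rooted_array \<alpha> \<beta> c)) = length \<beta>"
      using that by (simp add: rooted_array_def)
    then have "last (fst (rooted_array \<alpha> \<beta> c)) = fst (rooted_array \<alpha> \<beta> c) ! (length \<beta> - 1)"
      using that by (subst last_conv_nth) auto
    then show ?thesis
      using that by (auto simp: rooted_array_def nth_starred_row)
  qed
  from assms(1) show ?thesis
  proof (cases rule: toggle_zero_cases)
    case insert
    then show ?thesis
      using assms(2) first_bottom by (auto simp: degenerate_def star_columns_def)
  next
    case (delete \<gamma>)
    then show ?thesis
      using assms(2) last_top by (auto simp: degenerate_def star_columns_def)
  qed
qed

text \<open>A common starred column keeps the stars in the same row: the length of \<open>\<beta>\<close> cannot step
  over that of \<open>\<alpha>\<close> without becoming equal to it, which leaves no star.\<close>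

lemma sync_sign_toggle_zero:
  assumes "nonneg_distinct_partition \<beta>"
    and "c \<in> star_columns \<alpha> \<beta>" "c \<in> star_columns \<alpha> (toggle_zero \<beta>)"
  shows "sync_sign (rooted_array \<alpha> (toggle_zero \<beta>) c) = - sync_sign (rooted_array \<alpha> \<beta> c)"
  using assms(1)
proof (cases rule: toggle_zero_cases)
  case insert
  then show ?thesis
    using assms(2,3) by (auto simp: sync_sign_rooted_array star_columns_def)
next
  case (delete \<gamma>)
  then show ?thesis
    using assms(2,3) by (auto simp: sync_sign_rooted_array star_columns_def)
qed

section \<open>The involution\<close>

text \<open>Non-degeneracy is replaced by the condition that \<open>c\<close> is starred for \<open>\<beta>\<close> and for
  \<open>toggle_zero \<beta>\<close>; in this form every clause is visibly preserved by toggling.\<close>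

lemma nondegenerate_rooted_iff:
  "S \<in> nondegenerate_rooted m n p \<longleftrightarrow>
     (\<exists>\<alpha> \<beta> c. S = rooted_array \<alpha> \<beta> c \<and>
        pos_distinct_partition \<alpha> \<and> nonneg_distinct_partition \<beta> \<and>
        (\<alpha> \<noteq> [] \<longrightarrow> hd \<alpha> \<le> m) \<and> (\<beta> \<noteq> [] \<longrightarrow> hd \<beta> \<le> n) \<and>
        sum_list \<alpha> + sum_list \<beta> = p \<and>
        c \<in> star_columns \<alpha> \<beta> \<and> c \<in> star_columns \<alpha> (toggle_zero \<beta>))" (is "?nondeg \<longleftrightarrow> ?triple")
proof
  assume ?nondeg
  then obtain \<alpha> \<beta> c where S: "S = rooted_array \<alpha> \<beta> c" "c \<in> star_columns \<alpha> \<beta>"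
    and \<alpha>\<beta>: "pos_distinct_partition \<alpha>" "nonneg_distinct_partition \<beta>"
      "\<alpha> \<noteq> [] \<longrightarrow> hd \<alpha> \<le> m" "\<beta> \<noteq> [] \<longrightarrow> hd \<beta> \<le> n"
    and "weight S = p" "\<not> degenerate S"
    unfolding nondegenerate_rooted_def rooted_sync_partitions_def rooting_sync_iff by blast
  then have "sum_list \<alpha> + sum_list \<beta> = p" "c \<in> star_columns \<alpha> (toggle_zero \<beta>)"
    by (auto simp: weight_rooted_array degenerate_iff_toggle_unstars)
  with S \<alpha>\<beta> show ?triple
    by blast
next
  assume ?triple
  then show ?nondeg
    unfolding nondegenerate_rooted_def rooted_sync_partitions_def rooting_sync_iff
    by (force simp: weight_rooted_array degenerate_iff_toggle_unstars)
qed

definition toggle_array :: "array \<Rightarrow> array" where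
  "toggle_array S =
     rooted_array (top_parts S) (toggle_zero (bottom_parts S)) (root_column S)"

lemma toggle_array_rooted_array:
  "c \<in> star_columns \<alpha> \<beta> \<Longrightarrow>
     toggle_array (rooted_array \<alpha> \<beta> c) = rooted_array \<alpha> (toggle_zero \<beta>) c"
  by (simp add: toggle_array_def root_column_rooted_array)

theorem theorem3p1:
  fixes m n p :: nat
  shows "\<exists>\<tau> :: array \<Rightarrow> array.
           \<forall>S \<in> nondegenerate_rooted m n p.
             \<tau> S \<in> nondegenerate_rooted m n p \<and>
             \<tau> (\<tau> S) = S \<and>
             sync_sign (\<tau> S) = - sync_sign S"
proof (intro exI [where x = toggle_array] ballI)
  fix S
  assume "S \<in> nondegenerate_rooted m n p"
  then obtain \<alpha> \<beta> c where S: "S = rooted_array \<alpha> \<beta> c"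
    and \<alpha>: "pos_distinct_partition \<alpha>" "\<alpha> \<noteq> [] \<longrightarrow> hd \<alpha> \<le> m"
    and \<beta>: "nonneg_distinct_partition \<beta>" "\<beta> \<noteq> [] \<longrightarrow> hd \<beta> \<le> n"
    and p: "sum_list \<alpha> + sum_list \<beta> = p"
    and c: "c \<in> star_columns \<alpha> \<beta>" "c \<in> star_columns \<alpha> (toggle_zero \<beta>)"
    unfolding nondegenerate_rooted_iff by blast
  note toggle_twice = toggle_zero_toggle_zero [OF \<beta>(1)]
  have \<tau>S: "toggle_array S = rooted_array \<alpha> (toggle_zero \<beta>) c"
    using S c(1) by (simp add: toggle_array_rooted_array)
  have "toggle_array S \<in> nondegenerate_rooted m n p"
    unfolding nondegenerate_rooted_iff
  proof (intro exI conjI)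
    show "nonneg_distinct_partition (toggle_zero \<beta>)"
      by (rule nonneg_distinct_partition_toggle_zero [OF \<beta>(1)])
    show "toggle_zero \<beta> \<noteq> [] \<longrightarrow> hd (toggle_zero \<beta>) \<le> n"
      by (rule hd_toggle_zero_le [OF \<beta>])
    show "sum_list \<alpha> + sum_list (toggle_zero \<beta>) = p"
      using p by (simp add: sum_list_toggle_zero [OF \<beta>(1)])
    show "c \<in> star_columns \<alpha> (toggle_zero (toggle_zero \<beta>))"
      using c(1) by (simp add: toggle_twice)
  qed (fact \<tau>S \<alpha> c(2))+
  moreover have "toggle_array (toggle_array S) = S"
    using S \<tau>S c(2) by (simp add: toggle_array_rooted_array toggle_twice)
  moreover have "sync_sign (toggle_array S) = - sync_sign S"
    unfolding \<tau>S unfolding S by (rule sync_sign_toggle_zero [OF \<beta>(1) c])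
  ultimately show "toggle_array S \<in> nondegenerate_rooted m n p \<and>
      toggle_array (toggle_array S) = S \<and> sync_sign (toggle_array S) = - sync_sign S"
    by blast
qed

end
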